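(* Let $\Omega$ be a nonempty subset of $\mathbb{R}^n$ and let $F\in\mathcal{F}^1(\Omega)$ with $\kappa:=\Gamma^1(F;\Omega)>0$. Let $W^+(F,\Omega)$ be the 1-field associated to $w^+(F,\Omega)$ and let $W^-(F,\Omega)$ be the 1-field associated to $w^-(F,\Omega)$. Then $W^+(F,\Omega)$ is an over extremal Lipschitz extension of $F$ on $\mathbb{R}^n$ and $W^-(F,\Omega)$ is an under extremal Lipschitz extension of $F$ on $\mathbb{R}^n$.
   Context: Fix $n\ge1$; $\mathbb{R}^n$ carries the standard scalar product and Euclidean norm. A 1-field on a nonempty set $\Omega\subset\mathbb{R}^n$ is a map $F$ assigning to each $x\in \Omega$ the polynomial $F(x)(a)=f_x+\langle D_xf,a-x\rangle$ ($a\in\mathbb{R}^n$), where $f_x\in\mathbb{R}$ and $D_xf\in\mathbb{R}^n$ (a 1-field $G$ similarly has data $g(x)=g_x$, $D_xg$). For $x\ne y$ in $\Omega$, $\Gamma^1(F;x,y)=2\sup_{a\in\mathbb{R}^n}\frac{|F(x)(a)-F(y)(a)|}{\|x-a\|^2+\|y-a\|^2}$, and $\Gamma^1(F;\Omega)=\sup_{x\ne y\in \Omega}\Gamma^1(F;x,y)$ (supremum over the empty set being $0$). $\mathcal{F}^1(\Omega)$ is the set of 1-fields on $\Omega$ with $\Gamma^1(F;\Omega)<+\infty$. The 1-field associated to a $C^1$ function $w$ on $\mathbb{R}^n$ is $W(x)(a)=w(x)+\langle\nabla w(x),a-x\rangle$. For $\Omega_1\subset\Omega_2$ and $F\in\mathcal{F}^1(\Omega_1)$,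 $G\in\mathcal{F}^1(\Omega_2)$ is a minimal Lipschitz extension (MLE) of $F$ on $\Omega_2$ if $G(x)=F(x)$ for $x\in\Omega_1$ and $\Gamma^1(G;\Omega_2)=\Gamma^1(F;\Omega_1)$. An MLE $G$ of $F$ on $\Omega_2$ is over extremal (resp. under extremal) if $k(x)\le g(x)$ (resp. $g(x)\le k(x)$) for all $x\in\Omega_2$ and every MLE $K$ of $F$ on $\Omega_2$. Wells' construction on a nonempty finite set $A\subset\mathbb{R}^n$, with $F\in\mathcal{F}^1(A)$, $\kappa\ge\Gamma^1(F;A)$, $\kappa>0$. For $p\in A$ set $$\widetilde p^{\pm}=p\mp D_pf/\kappa,\qquad d_p^{\pm}(x)=f_p\mp\tfrac{1}{2\kappa}\|D_pf\|^2\pm\tfrac{\kappa}{4}\|x-\widetilde p^{\pm}\|^2 .$$ For $\emptyset\neq S\subset A$ set $d_S^+(x)=\inf_{p\in S}d_p^+(x)$, $d_S^-(x)=\sup_{p\in S}d_p^-(x)$ (with $\inf\emptyset=+\infty$, $\sup\emptyset=-\infty$ when the index set $A\setminus S$ is empty); $\widetilde S^\pm=\{\widetilde p^\pm:p\in S\}$; $\widehat S^\pm$ = convex hull of $\widetilde S^\pm$; $S_H^\pm$ = smallest affine subspace containing $\widetilde S^\pm$; $S_E^\pm=\{x: d_p^\pm(x)=d_{p'}^\pm(x)\ \forall p,p'\in S\}$; $$S_*^+=\{x:d_p^+(x)=d_{p'}^+(x)\le d_{p''}^+(x)\ \forall p,p'\in S,\ p''\in A\},$$ $$S_*^-=\{x:d_p^-(x)=d_{p'}^-(x)\ge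 d_{p''}^-(x)\ \forall p,p'\in S,\ p''\in A\};$$ $K^+$ = set of those $S$ for which there is $x\in S_*^+$ with $d_S^+(x)<d_{A\setminus S}^+(x)$; $K^-$ = set of those $S$ for which there is $x\in S_*^-$ with $d_S^-(x)>d_{A\setminus S}^-(x)$. For $S\in K^\pm$, $S_C^\pm=S_E^\pm\cap S_H^\pm$ is a single point, and $T_S^\pm=\{\frac12(y+z):y\in\widehat S^\pm,\ z\in S_*^\pm\}$. The sets $T_S^\pm$, $S\in K^\pm$, cover $\mathbb{R}^n$ and have pairwise disjoint interiors. With $d(x,\cdot)$ the Euclidean distance to a set, put for $x\in T_S^\pm$ $$w^\pm(F,A,\kappa)(x)=d_S^\pm(S_C^\pm)\pm\tfrac{\kappa}{2}d^2(x,S_H^\pm)\mp\tfrac{\kappa}{2}d^2(x,S_E^\pm).$$ It is known (Wells) that this is well defined on $\mathbb{R}^n$ and continuously differentiable. For a general nonempty $\Omega$, $F\in\mathcal{F}^1(\Omega)$ with $\kappa=\Gamma^1(F;\Omega)>0$, let $\mathcal{P}$ be the set of nonempty finite subsets of $\Omega$ and define, for $x\in\mathbb{R}^n$, $$w^+(F,\Omega)(x)=\inf_{P\in\mathcal{P}}w^+(F,P,\kappa)(x),\qquad w^-(F,\Omega)(x)=\sup_{P\in\mathcal{P}}w^-(F,P,\kappa)(x)$$ ($F$ restricted to $P$). These functions are known to be continuously differentiable. *)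

theory Defs
  imports "HOL-Analysis.Analysis"
begin

text \<open>A 1-field is given by its data: \<open>F x = (f\<^sub>x, D\<^sub>xf)\<close>. Fields are total functions; a field on
  \<open>\<Omega>\<close> is one of which only the values on \<open>\<Omega>\<close> are used.\<close>

type_synonym 'a field1 = "'a \<Rightarrow> real \<times> 'a"

definition fval :: "'a field1 \<Rightarrow> 'a \<Rightarrow> real" where
  "fval F x = fst (F x)"

definition fgrad :: "'a field1 \<Rightarrow> 'a \<Rightarrow> 'a" where
  "fgrad F x = snd (F x)"

definition fpoly :: "'a::euclidean_space field1 \<Rightarrow> 'a \<Rightarrow> 'a \<Rightarrow> real" where
  "fpoly F x a = fval F x + fgrad F x \<bullet> (a - x)"

text \<open>Suprema are taken in \<open>[0,\<infinity>]\<close>, so the supremum of the empty set is 0.\<close>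

definition Gamma1_at :: "'a::euclidean_space field1 \<Rightarrow> 'a \<Rightarrow> 'a \<Rightarrow> ennreal" where
  "Gamma1_at F x y =
     2 * (SUP a. ennreal (\<bar>fpoly F x a - fpoly F y a\<bar> / ((norm (x - a))\<^sup>2 + (norm (y - a))\<^sup>2)))"

definition Gamma1 :: "'a::euclidean_space field1 \<Rightarrow> 'a set \<Rightarrow> ennreal" where
  "Gamma1 F \<Omega> = (SUP (x, y) \<in> {(x, y). x \<in> \<Omega> \<and> y \<in> \<Omega> \<and> x \<noteq> y}. Gamma1_at F x y)"

definition fields1 :: "'a::euclidean_space set \<Rightarrow> 'a field1 set" where
  "fields1 \<Omega> = {F. Gamma1 F \<Omega> < \<infinity>}"

definition gradient :: "('a::euclidean_space \<Rightarrow> real) \<Rightarrow> 'a \<Rightarrow> 'a" where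
  "gradient w x = (THE D. GDERIV w x :> D)"

definition assoc_field :: "('a::euclidean_space \<Rightarrow> real) \<Rightarrow> 'a field1" where
  "assoc_field w x = (w x, gradient w x)"

definition is_MLE :: "'a::euclidean_space field1 \<Rightarrow> 'a set \<Rightarrow> 'a field1 \<Rightarrow> 'a set \<Rightarrow> bool" where
  "is_MLE F \<Omega>\<^sub>1 G \<Omega>\<^sub>2 \<longleftrightarrow>
     \<Omega>\<^sub>1 \<subseteq> \<Omega>\<^sub>2 \<and> F \<in> fields1 \<Omega>\<^sub>1 \<and> G \<in> fields1 \<Omega>\<^sub>2 \<and>
     (\<forall>x\<in>\<Omega>\<^sub>1. fpoly G x = fpoly F x) \<and> Gamma1 G \<Omega>\<^sub>2 = Gamma1 F \<Omega>\<^sub>1"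

definition over_extremal :: "'a::euclidean_space field1 \<Rightarrow> 'a set \<Rightarrow> 'a field1 \<Rightarrow> 'a set \<Rightarrow> bool" where
  "over_extremal F \<Omega>\<^sub>1 G \<Omega>\<^sub>2 \<longleftrightarrow>
     is_MLE F \<Omega>\<^sub>1 G \<Omega>\<^sub>2 \<and> (\<forall>K. is_MLE F \<Omega>\<^sub>1 K \<Omega>\<^sub>2 \<longrightarrow> (\<forall>x\<in>\<Omega>\<^sub>2. fval K x \<le> fval G x))"

definition under_extremal :: "'a::euclidean_space field1 \<Rightarrow> 'a set \<Rightarrow> 'a field1 \<Rightarrow> 'a set \<Rightarrow> bool" where
  "under_extremal F \<Omega>\<^sub>1 G \<Omega>\<^sub>2 \<longleftrightarrow>
     is_MLE F \<Omega>\<^sub>1 G \<Omega>\<^sub>2 \<and> (\<forall>K. is_MLE F \<Omega>\<^sub>1 K \<Omega>\<^sub>2 \<longrightarrow> (\<forall>x\<in>\<Omega>\<^sub>2. fval G x \<le> fval K x))"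

text \<open>Wells' construction for a finite set \<open>A\<close>. The superscripts \<open>+\<close> and \<open>-\<close> become an argument
  of type \<open>sign\<close>; \<open>sg s\<close> is the number that replaces \<open>\<plusminus>\<close>.\<close>

datatype sign = Plus | Minus

fun sg :: "sign \<Rightarrow> real" where
  "sg Plus = 1"
| "sg Minus = -1"

definition wtilde :: "sign \<Rightarrow> 'a::euclidean_space field1 \<Rightarrow> real \<Rightarrow> 'a \<Rightarrow> 'a" where
  "wtilde s F \<kappa> p = p - (sg s / \<kappa>) *\<^sub>R fgrad F p"

definition wd :: "sign \<Rightarrow> 'a::euclidean_space field1 \<Rightarrow> real \<Rightarrow> 'a \<Rightarrow> 'a \<Rightarrow> real" where
  "wd s F \<kappa> p x =
     fval F p - sg s * (1 / (2 * \<kappa>)) * (norm (fgrad F p))\<^sup>2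
              + sg s * (\<kappa> / 4) * (norm (x - wtilde s F \<kappa> p))\<^sup>2"

text \<open>Extended reals give the values \<open>\<infinity>\<close> resp. \<open>-\<infinity>\<close> on the empty index set.\<close>

fun wdset :: "sign \<Rightarrow> 'a::euclidean_space field1 \<Rightarrow> real \<Rightarrow> 'a set \<Rightarrow> 'a \<Rightarrow> ereal" where
  "wdset Plus F \<kappa> S x = (INF p\<in>S. ereal (wd Plus F \<kappa> p x))"
| "wdset Minus F \<kappa> S x = (SUP p\<in>S. ereal (wd Minus F \<kappa> p x))"

definition whull :: "sign \<Rightarrow> 'a::euclidean_space field1 \<Rightarrow> real \<Rightarrow> 'a set \<Rightarrow> 'a set" where
  "whull s F \<kappa> S = convex hull (wtilde s F \<kappa> ` S)"

definition wS_H :: "sign \<Rightarrow> 'a::euclidean_space field1 \<Rightarrow> real \<Rightarrow> 'a set \<Rightarrow> 'a set" where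
  "wS_H s F \<kappa> S = affine hull (wtilde s F \<kappa> ` S)"

definition wS_E :: "sign \<Rightarrow> 'a::euclidean_space field1 \<Rightarrow> real \<Rightarrow> 'a set \<Rightarrow> 'a set" where
  "wS_E s F \<kappa> S = {x. \<forall>p\<in>S. \<forall>p'\<in>S. wd s F \<kappa> p x = wd s F \<kappa> p' x}"

fun wS_star :: "sign \<Rightarrow> 'a::euclidean_space field1 \<Rightarrow> 'a set \<Rightarrow> real \<Rightarrow> 'a set \<Rightarrow> 'a set" where
  "wS_star Plus F A \<kappa> S =
     {x. \<forall>p\<in>S. \<forall>p'\<in>S. \<forall>p''\<in>A. wd Plus F \<kappa> p x = wd Plus F \<kappa> p' x \<and>
                                wd Plus F \<kappa> p' x \<le> wd Plus F \<kappa> p'' x}"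
| "wS_star Minus F A \<kappa> S =
     {x. \<forall>p\<in>S. \<forall>p'\<in>S. \<forall>p''\<in>A. wd Minus F \<kappa> p x = wd Minus F \<kappa> p' x \<and>
                                wd Minus F \<kappa> p' x \<ge> wd Minus F \<kappa> p'' x}"

fun wK :: "sign \<Rightarrow> 'a::euclidean_space field1 \<Rightarrow> 'a set \<Rightarrow> real \<Rightarrow> 'a set set" where
  "wK Plus F A \<kappa> = {S. S \<noteq> {} \<and> S \<subseteq> A \<and>
     (\<exists>x\<in>wS_star Plus F A \<kappa> S. wdset Plus F \<kappa> S x < wdset Plus F \<kappa> (A - S) x)}"
| "wK Minus F A \<kappa> = {S. S \<noteq> {} \<and> S \<subseteq> A \<and>
     (\<exists>x\<in>wS_star Minus F A \<kappa> S. wdset Minus F \<kappa> S x > wdset Minus F \<kappa> (A - S) x)}"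

definition wS_C :: "sign \<Rightarrow> 'a::euclidean_space field1 \<Rightarrow> real \<Rightarrow> 'a set \<Rightarrow> 'a" where
  "wS_C s F \<kappa> S = (THE c. c \<in> wS_E s F \<kappa> S \<inter> wS_H s F \<kappa> S)"

definition wT :: "sign \<Rightarrow> 'a::euclidean_space field1 \<Rightarrow> 'a set \<Rightarrow> real \<Rightarrow> 'a set \<Rightarrow> 'a set" where
  "wT s F A \<kappa> S = {(1/2) *\<^sub>R (y + z) | y z. y \<in> whull s F \<kappa> S \<and> z \<in> wS_star s F A \<kappa> S}"

definition wpiece :: "sign \<Rightarrow> 'a::euclidean_space field1 \<Rightarrow> real \<Rightarrow> 'a set \<Rightarrow> 'a \<Rightarrow> real" where
  "wpiece s F \<kappa> S x =
     real_of_ereal (wdset s F \<kappa> S (wS_C s F \<kappa> S))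
       + sg s * (\<kappa> / 2) * (infdist x (wS_H s F \<kappa> S))\<^sup>2
       - sg s * (\<kappa> / 2) * (infdist x (wS_E s F \<kappa> S))\<^sup>2"

text \<open>The value common to all the pieces whose cell \<open>T\<^sub>S\<close> contains \<open>x\<close>.\<close>

definition wells :: "sign \<Rightarrow> 'a::euclidean_space field1 \<Rightarrow> 'a set \<Rightarrow> real \<Rightarrow> 'a \<Rightarrow> real" where
  "wells s F A \<kappa> x = (THE v. \<exists>S\<in>wK s F A \<kappa>. x \<in> wT s F A \<kappa> S \<and> v = wpiece s F \<kappa> S x)"

definition w_plus :: "'a::euclidean_space field1 \<Rightarrow> 'a set \<Rightarrow> 'a \<Rightarrow> real" where
  "w_plus F \<Omega> x =
     (INF P\<in>{P. P \<noteq> {} \<and> finite P \<and> P \<subseteq> \<Omega>}. wells Plus F P (enn2real (Gamma1 F \<Omega>)) x)"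

definition w_minus :: "'a::euclidean_space field1 \<Rightarrow> 'a set \<Rightarrow> 'a \<Rightarrow> real" where
  "w_minus F \<Omega> x =
     (SUP P\<in>{P. P \<noteq> {} \<and> finite P \<and> P \<subseteq> \<Omega>}. wells Minus F P (enn2real (Gamma1 F \<Omega>)) x)"

end

theory Submission
  imports Defs
begin

text \<open>
  Everything rests on a closed formula for Wells' function. For a finite set \<open>A\<close> and \<open>\<kappa> > 0\<close>,
  \<open>w\<^sup>+(F,A,\<kappa>)(x)\<close> is the maximum over \<open>z\<close> of the minimum over \<open>p \<in> A\<close> of
  \<open>d\<^sub>p(z) - \<kappa>/2 \<parallel>x - z\<parallel>\<^sup>2\<close>, where \<open>d\<^sub>p\<close> and \<open>p\<^sup>~\<close> carry the sign \<open>+\<close>.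
  Call this last function of \<open>z\<close> the height of \<open>p\<close>. It is a concave paraboloid with the same quadratic
  part \<open>-\<kappa>/4 \<parallel>z\<parallel>\<^sup>2\<close> for every \<open>p\<close>, and its largest value is the paraboloid
  \<open>F(p)(x) + \<kappa>/2 \<parallel>x - p\<parallel>\<^sup>2\<close>, taken at \<open>z = 2x - p\<^sup>~\<close>. The minimum over \<open>p\<close> is
  therefore strongly concave, and a point \<open>z\<close> is its peak exactly when \<open>2x - z\<close> lies in the convex hull
  of the points \<open>p\<^sup>~\<close> whose height is the smallest at \<open>z\<close>. Writing \<open>y = 2x - z\<close>, this says
  that \<open>x = (y + z)/2\<close> lies in the cell \<open>T\<^sub>S\<close> for the set \<open>S\<close> of these \<open>p\<close>. As \<open>S\<^sub>E\<close> and \<open>S\<^sub>H\<close> are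
  orthogonal and meet in \<open>S\<^sub>C\<close>, Pythagoras turns the height of the peak into the formula that
  defines Wells' function on the cell. In particular the cells cover the space and the pieces
  agree where cells overlap.

  Superlevel sets of the height are compact, so passing to the infimum over the finite subsets of
  \<open>\<Omega>\<close> keeps the peak: \<open>w\<^sup>+(F,\<Omega>)(x)\<close> is the largest \<open>m\<close> that is below the height of
  all \<open>p \<in> \<Omega>\<close> at some common \<open>z\<close> (\<open>peak_of_inf_wells\<close>). From this description:

  \<^item> Comparing the peaks of two points \<open>x\<close> and \<open>a\<close> gives
    \<open>\<bar>w(a) - w(x) - \<kappa>(z - x) \<bullet> (a - x)\<bar> \<le> \<kappa>/2 \<parallel>a - x\<parallel>\<^sup>2\<close> where \<open>z\<close> is the peak for
    \<open>x\<close>; the lower half uses \<open>z\<close> as a competitor for \<open>a\<close>, the upper half the strong concavity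
    (\<open>peak_taylor\<close>). So \<open>w\<close> is differentiable with gradient \<open>\<kappa>(z - x)\<close>, and its field has
    \<open>\<Gamma>\<^sup>1 \<le> \<kappa>\<close>.

  \<^item> The condition \<open>\<Gamma>\<^sup>1 \<le> \<kappa>\<close> says that each lower paraboloid
    \<open>K(x)(a) - \<kappa>/2 \<parallel>a - x\<parallel>\<^sup>2\<close> is below each upper paraboloid
    \<open>K(y)(a) + \<kappa>/2 \<parallel>a - y\<parallel>\<^sup>2\<close>. A lower paraboloid that is below the upper paraboloids of all
    \<open>p \<in> \<Omega>\<close> is below \<open>w\<^sup>+\<close>: the point \<open>z = x + D/\<kappa>\<close>, with \<open>D\<close> its slope at \<open>x\<close>,
    is a competitor (\<open>lower_paraboloid_le_height\<close>). For the lower paraboloids of \<open>F\<close> itself this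
    yields that \<open>w\<^sup>+\<close> extends \<open>F\<close>, and for those of an arbitrary minimal extension that \<open>w\<^sup>+\<close>
    dominates it.

  The under extremal case is the over extremal case for the field \<open>-F\<close>.
\<close>

section \<open>The condition on the fields as a comparison of paraboloids\<close>

definition upper_paraboloid :: "'a::euclidean_space field1 \<Rightarrow> real \<Rightarrow> 'a \<Rightarrow> 'a \<Rightarrow> real" where
  "upper_paraboloid F \<kappa> p a = fpoly F p a + \<kappa> / 2 * (norm (a - p))\<^sup>2"

definition lower_paraboloid :: "'a::euclidean_space field1 \<Rightarrow> real \<Rightarrow> 'a \<Rightarrow> 'a \<Rightarrow> real" where
  "lower_paraboloid F \<kappa> p a = fpoly F p a - \<kappa> / 2 * (norm (a - p))\<^sup>2"

lemma Gamma1_at_le_iff: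
  assumes "0 \<le> \<kappa>" "x \<noteq> y"
  shows "Gamma1_at F x y \<le> ennreal \<kappa> \<longleftrightarrow>
    (\<forall>a. \<bar>fpoly F x a - fpoly F y a\<bar> \<le> \<kappa> / 2 * ((norm (a - x))\<^sup>2 + (norm (a - y))\<^sup>2))"
proof -
  have pos: "0 < (norm (x - a))\<^sup>2 + (norm (y - a))\<^sup>2" for a
    using assms(2) by (metis eq_iff_diff_eq_0 sum_power2_gt_zero_iff norm_eq_zero)
  have two: "2 * ennreal t = ennreal (2 * t)" if "0 \<le> t" for t
    using that by (simp add: ennreal_mult)
  have "Gamma1_at F x y \<le> ennreal \<kappa> \<longleftrightarrow>
     (\<forall>a. 2 * (\<bar>fpoly F x a - fpoly F y a\<bar> / ((norm (x - a))\<^sup>2 + (norm (y - a))\<^sup>2)) \<le> \<kappa>)"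
    unfolding Gamma1_at_def SUP_mult_left_ennreal
    using assms(1) by (simp add: SUP_le_iff two)
  also have "\<dots> \<longleftrightarrow>
    (\<forall>a. \<bar>fpoly F x a - fpoly F y a\<bar> \<le> \<kappa> / 2 * ((norm (a - x))\<^sup>2 + (norm (a - y))\<^sup>2))"
  proof (intro all_cong1)
    fix a
    show "2 * (\<bar>fpoly F x a - fpoly F y a\<bar> / ((norm (x - a))\<^sup>2 + (norm (y - a))\<^sup>2)) \<le> \<kappa> \<longleftrightarrow>
      \<bar>fpoly F x a - fpoly F y a\<bar> \<le> \<kappa> / 2 * ((norm (a - x))\<^sup>2 + (norm (a - y))\<^sup>2)"
      using pos[of a] by (simp add: norm_minus_commute[of a] pos_divide_le_eq mult.commute)
  qed
  finally show ?thesis .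
qed

text \<open>The absolute value in the definition splits into two comparisons, which exchange the roles of
\<open>x\<close> and \<open>y\<close>; pairs with \<open>x = y\<close> may be included since a lower paraboloid is below the upper
paraboloid with the same centre.\<close>

lemma Gamma1_le_iff:
  assumes "0 \<le> \<kappa>"
  shows "Gamma1 F \<Omega> \<le> ennreal \<kappa> \<longleftrightarrow>
    (\<forall>x\<in>\<Omega>. \<forall>y\<in>\<Omega>. \<forall>a. lower_paraboloid F \<kappa> x a \<le> upper_paraboloid F \<kappa> y a)"
proof -
  have "Gamma1 F \<Omega> \<le> ennreal \<kappa> \<longleftrightarrow> (\<forall>x\<in>\<Omega>. \<forall>y\<in>\<Omega>. x \<noteq> y \<longrightarrow> Gamma1_at F x y \<le> ennreal \<kappa>)"
    by (auto simp: Gamma1_def SUP_le_iff)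
  also have "\<dots> \<longleftrightarrow> (\<forall>x\<in>\<Omega>. \<forall>y\<in>\<Omega>. x \<noteq> y \<longrightarrow>
      (\<forall>a. \<bar>fpoly F x a - fpoly F y a\<bar> \<le> \<kappa> / 2 * ((norm (a - x))\<^sup>2 + (norm (a - y))\<^sup>2)))"
    using Gamma1_at_le_iff[OF assms] by blast
  also have "\<dots> \<longleftrightarrow> (\<forall>x\<in>\<Omega>. \<forall>y\<in>\<Omega>.
      (\<forall>a. \<bar>fpoly F x a - fpoly F y a\<bar> \<le> \<kappa> / 2 * ((norm (a - x))\<^sup>2 + (norm (a - y))\<^sup>2)))"
  proof (intro ball_cong refl)
    fix x y
    show "(x \<noteq> y \<longrightarrow> (\<forall>a. \<bar>fpoly F x a - fpoly F y a\<bar> \<le> \<kappa> / 2 * ((norm (a - x))\<^sup>2 + (norm (a - y))\<^sup>2))) \<longleftrightarrow>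
      (\<forall>a. \<bar>fpoly F x a - fpoly F y a\<bar> \<le> \<kappa> / 2 * ((norm (a - x))\<^sup>2 + (norm (a - y))\<^sup>2))"
      using assms by (cases "x = y") auto
  qed
  also have "\<dots> \<longleftrightarrow> (\<forall>x\<in>\<Omega>. \<forall>y\<in>\<Omega>. \<forall>a. lower_paraboloid F \<kappa> x a \<le> upper_paraboloid F \<kappa> y a)"
  proof -
    have *: "\<bar>fpoly F x a - fpoly F y a\<bar> \<le> \<kappa> / 2 * ((norm (a - x))\<^sup>2 + (norm (a - y))\<^sup>2) \<longleftrightarrow>
        lower_paraboloid F \<kappa> x a \<le> upper_paraboloid F \<kappa> y a \<and>
        lower_paraboloid F \<kappa> y a \<le> upper_paraboloid F \<kappa> x a" for x y a
      by (auto simp: lower_paraboloid_def upper_paraboloid_def abs_le_iff distrib_left)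
    show ?thesis
      unfolding * by blast
  qed
  finally show ?thesis .
qed

section \<open>The height function and its peak\<close>

text \<open>The function of \<open>z\<close> whose minimum over \<open>p\<close> is maximised in the formula for Wells' function.\<close>

definition height :: "'a::euclidean_space field1 \<Rightarrow> real \<Rightarrow> 'a \<Rightarrow> 'a \<Rightarrow> 'a \<Rightarrow> real" where
  "height F \<kappa> x p z = wd Plus F \<kappa> p z - \<kappa> / 2 * (norm (x - z))\<^sup>2"

text \<open>Completing the square. This identity links Wells' paraboloids \<open>d\<^sub>p\<close>, centred at \<open>p\<^sup>~\<close>, with the
paraboloids centred at \<open>p\<close> that occur in the condition on the field.\<close>

lemma height_eq:
  assumes "0 < \<kappa>"
  shows "height F \<kappa> x p z =
    upper_paraboloid F \<kappa> p x - \<kappa> / 4 * (norm (z - (2 *\<^sub>R x - wtilde Plus F \<kappa> p)))\<^sup>2"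
proof -
  define D where "D = (1 / \<kappa>) *\<^sub>R fgrad F p"
  have D: "fgrad F p = \<kappa> *\<^sub>R D"
    using assms by (simp add: D_def)
  have t: "wtilde Plus F \<kappa> p = p - D"
    by (simp add: wtilde_def D_def)
  have n': "sg Plus * (1 / (2 * \<kappa>)) * (norm (fgrad F p))\<^sup>2 = \<kappa> / 2 * (D \<bullet> D)"
    using assms unfolding power2_norm_eq_inner D
    by (simp add: field_simps)
  show ?thesis
    unfolding height_def wd_def upper_paraboloid_def fpoly_def t n'
    unfolding D power2_norm_eq_inner
    by (simp add: inner_diff_left inner_diff_right inner_commute algebra_simps)
qed

lemma height_shift:
  "height F \<kappa> a p z = height F \<kappa> x p z + \<kappa> / 2 * (norm (x - z))\<^sup>2 - \<kappa> / 2 * (norm (a - z))\<^sup>2"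
  by (simp add: height_def)

lemma height_move:
  assumes "0 < \<kappa>"
  shows "height F \<kappa> x p (z + v) = height F \<kappa> x p z
    + \<kappa> / 2 * (v \<bullet> (2 *\<^sub>R x - z - wtilde Plus F \<kappa> p)) - \<kappa> / 4 * (norm v)\<^sup>2"
  unfolding height_eq[OF assms] power2_norm_eq_inner
  by (simp add: inner_diff_left inner_diff_right inner_add_left inner_add_right inner_commute algebra_simps)

text \<open>The excess over the linear interpolation is independent of \<open>p\<close>, so it survives the minimum over
\<open>p\<close> and makes that minimum strongly concave.\<close>

lemma height_segment:
  assumes "0 < \<kappa>"
  shows "height F \<kappa> x p (z + t *\<^sub>R (\<zeta> - z)) =
    (1 - t) * height F \<kappa> x p z + t * height F \<kappa> x p \<zeta> + \<kappa> / 4 * t * (1 - t) * (norm (\<zeta> - z))\<^sup>2"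
proof -
  have \<zeta>: "height F \<kappa> x p \<zeta> = height F \<kappa> x p (z + (\<zeta> - z))"
    by simp
  show ?thesis
    unfolding \<zeta> height_move[OF assms, of F x p z] norm_scaleR power_mult_distrib inner_scaleR_left power2_abs
    by (simp add: field_simps power2_eq_square del: scaleR_right_diff_distrib)
qed

text \<open>The minimum over \<open>p\<close> is expressed through its lower bounds \<open>m\<close>: over an infinite \<open>\<Omega>\<close> the infimum
of the heights can be \<open>-\<infinity>\<close> at some \<open>z\<close>, and such \<open>z\<close> have no lower bound and do not compete.\<close>

definition is_peak :: "'a::euclidean_space field1 \<Rightarrow> real \<Rightarrow> 'a set \<Rightarrow> 'a \<Rightarrow> 'a \<Rightarrow> real \<Rightarrow> bool" where
  "is_peak F \<kappa> \<Omega> x z M \<longleftrightarrow> (\<forall>p\<in>\<Omega>. M \<le> height F \<kappa> x p z) \<and>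
     (\<forall>\<zeta> m. (\<forall>p\<in>\<Omega>. m \<le> height F \<kappa> x p \<zeta>) \<longrightarrow> m \<le> M)"

text \<open>Strong concavity forces quadratic decay away from the peak: at \<open>z + t(\<zeta> - z)\<close> the heights are
at least \<open>(1 - t)M + tm + \<kappa>/4 t(1 - t) \<parallel>\<zeta> - z\<parallel>\<^sup>2\<close>, which cannot exceed \<open>M\<close>. Divide by \<open>t\<close>
and let \<open>t\<close> tend to 0.\<close>

lemma peak_decay:
  assumes \<kappa>: "0 < \<kappa>" and peak: "is_peak F \<kappa> \<Omega> x z M"
    and m: "\<And>p. p \<in> \<Omega> \<Longrightarrow> m \<le> height F \<kappa> x p \<zeta>"
  shows "m + \<kappa> / 4 * (norm (\<zeta> - z))\<^sup>2 \<le> M"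
proof -
  have *: "m + \<kappa> / 4 * (1 - t) * (norm (\<zeta> - z))\<^sup>2 \<le> M" if t: "0 < t" "t < 1" for t
  proof -
    have "(1 - t) * M + t * m + \<kappa> / 4 * t * (1 - t) * (norm (\<zeta> - z))\<^sup>2 \<le> M"
    proof -
      have "(1 - t) * M + t * m + \<kappa> / 4 * t * (1 - t) * (norm (\<zeta> - z))\<^sup>2
          \<le> height F \<kappa> x p (z + t *\<^sub>R (\<zeta> - z))" if "p \<in> \<Omega>" for p
        unfolding height_segment[OF \<kappa>]
        using t m[OF that] peak that unfolding is_peak_def
        by (intro add_mono[OF add_mono[OF mult_left_mono mult_left_mono] order_refl]) auto
      then show ?thesis
        using peak unfolding is_peak_def by blast
    qed
    then have "t * (m + \<kappa> / 4 * (1 - t) * (norm (\<zeta> - z))\<^sup>2) \<le> t * M"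
      by (simp add: algebra_simps)
    then show ?thesis
      using t by simp
  qed
  have "((\<lambda>t. m + \<kappa> / 4 * (1 - t) * (norm (\<zeta> - z))\<^sup>2) \<longlongrightarrow>
      m + \<kappa> / 4 * (1 - 0) * (norm (\<zeta> - z))\<^sup>2) (at_right 0)"
    by (intro tendsto_intros)
  moreover have "\<forall>\<^sub>F t in at_right 0. m + \<kappa> / 4 * (1 - t) * (norm (\<zeta> - z))\<^sup>2 \<le> M"
    using * by (auto simp: eventually_at_right_field intro!: exI[of _ 1])
  ultimately show ?thesis
    using tendsto_upperbound by fastforce
qed

text \<open>Changing \<open>x\<close> to \<open>a\<close> shifts all heights at a fixed \<open>z\<close> by the same amount, so the peak of either point
is a competitor for the other. Using it at \<open>a\<close> gives the lower bound on \<open>M'\<close>. Using it at \<open>x\<close> only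
bounds \<open>M'\<close> by a term that depends on \<open>z'\<close>; the decay at the peak turns that term into a square.\<close>

lemma peak_taylor:
  assumes \<kappa>: "0 < \<kappa>" and x: "is_peak F \<kappa> \<Omega> x z M" and a: "is_peak F \<kappa> \<Omega> a z' M'"
  shows "\<bar>M' - M - (\<kappa> *\<^sub>R (z - x)) \<bullet> (a - x)\<bar> \<le> \<kappa> / 2 * (norm (a - x))\<^sup>2"
proof -
  have "M + \<kappa> / 2 * (norm (x - z))\<^sup>2 - \<kappa> / 2 * (norm (a - z))\<^sup>2 \<le> M'"
  proof -
    have "\<forall>p\<in>\<Omega>. M + \<kappa> / 2 * (norm (x - z))\<^sup>2 - \<kappa> / 2 * (norm (a - z))\<^sup>2 \<le> height F \<kappa> a p z"
      using x unfolding is_peak_def height_shift[of F \<kappa> a _ z x] by simp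
    then show ?thesis
      using a unfolding is_peak_def by blast
  qed
  moreover have "\<kappa> / 2 * (norm (x - z))\<^sup>2 - \<kappa> / 2 * (norm (a - z))\<^sup>2
      = (\<kappa> *\<^sub>R (z - x)) \<bullet> (a - x) - \<kappa> / 2 * (norm (a - x))\<^sup>2"
    unfolding power2_norm_eq_inner
    by (simp add: inner_diff_left inner_diff_right inner_commute algebra_simps)
  moreover have "M' + \<kappa> / 2 * (norm (a - z'))\<^sup>2 - \<kappa> / 2 * (norm (x - z'))\<^sup>2
      + \<kappa> / 4 * (norm (z' - z))\<^sup>2 \<le> M"
    using a by (intro peak_decay[OF \<kappa> x]) (simp add: is_peak_def height_shift[of F \<kappa> x _ z' a])
  moreover have "\<kappa> / 2 * (norm (a - z'))\<^sup>2 - \<kappa> / 2 * (norm (x - z'))\<^sup>2 + \<kappa> / 4 * (norm (z' - z))\<^sup>2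
      = \<kappa> / 4 * (norm (z' - z - 2 *\<^sub>R (a - x)))\<^sup>2
        - (\<kappa> *\<^sub>R (z - x)) \<bullet> (a - x) - \<kappa> / 2 * (norm (a - x))\<^sup>2"
    unfolding power2_norm_eq_inner
    by (simp add: inner_diff_left inner_diff_right inner_commute algebra_simps)
  moreover have "0 \<le> \<kappa> / 4 * (norm (z' - z - 2 *\<^sub>R (a - x)))\<^sup>2"
    using \<kappa> by simp
  ultimately show ?thesis
    by linarith
qed

lemma continuous_on_Min:
  fixes f :: "'i \<Rightarrow> 'a::topological_space \<Rightarrow> real"
  assumes "finite A" "A \<noteq> {}" "\<And>p. p \<in> A \<Longrightarrow> continuous_on T (f p)"
  shows "continuous_on T (\<lambda>z. Min ((\<lambda>p. f p z) ` A))"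
  using assms
proof (induction A rule: finite_ne_induct)
  case (insert p A)
  then have "(\<lambda>z. Min ((\<lambda>p. f p z) ` insert p A)) = (\<lambda>z. min (f p z) (Min ((\<lambda>p. f p z) ` A)))"
    by (simp add: fun_eq_iff)
  then show ?case
    using insert by (simp add: continuous_on_min)
qed simp

text \<open>The superlevel sets are closed balls by \<open>height_eq\<close>.\<close>

lemma compact_superlevel_height:
  assumes "0 < \<kappa>"
  shows "compact {z. M \<le> height F \<kappa> x p z}"
proof -
  define r where "r = 4 / \<kappa> * (upper_paraboloid F \<kappa> p x - M)"
  have "{z. M \<le> height F \<kappa> x p z} =
      {z. (norm (z - (2 *\<^sub>R x - wtilde Plus F \<kappa> p)))\<^sup>2 \<le> r}"
    unfolding height_eq[OF assms] r_def using assms by (auto simp: field_simps)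
  moreover have "closed {z. (norm (z - (2 *\<^sub>R x - wtilde Plus F \<kappa> p)))\<^sup>2 \<le> r}"
    by (intro closed_Collect_le continuous_intros)
  moreover have "bounded {z. (norm (z - (2 *\<^sub>R x - wtilde Plus F \<kappa> p)))\<^sup>2 \<le> r}"
  proof (rule bounded_subset[OF bounded_cball])
    show "{z. (norm (z - (2 *\<^sub>R x - wtilde Plus F \<kappa> p)))\<^sup>2 \<le> r}
        \<subseteq> cball (2 *\<^sub>R x - wtilde Plus F \<kappa> p) (sqrt r)"
      by (auto simp: dist_norm norm_minus_commute real_le_rsqrt)
  qed
  ultimately show ?thesis
    by (simp add: compact_eq_bounded_closed)
qed

lemma finite_peak_exists:
  assumes \<kappa>: "0 < \<kappa>" and A: "finite A" "A \<noteq> {}"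
  obtains z M where "is_peak F \<kappa> A x z M"
proof -
  define h where "h z = Min ((\<lambda>p. height F \<kappa> x p z) ` A)" for z
  obtain p where p: "p \<in> A"
    using A by blast
  have cont: "continuous_on T h" for T
    unfolding h_def
    by (rule continuous_on_Min[OF A]) (auto simp: height_eq[OF \<kappa>] intro!: continuous_intros)
  have h: "m \<le> h z \<longleftrightarrow> (\<forall>p\<in>A. m \<le> height F \<kappa> x p z)" for m z
    unfolding h_def using A by simp
  have "compact ({z. h 0 \<le> height F \<kappa> x p z} \<inter> {z. h 0 \<le> h z})"
    by (intro compact_Int_closed compact_superlevel_height[OF \<kappa>] closed_Collect_le continuous_intros cont)
  moreover have "0 \<in> {z. h 0 \<le> height F \<kappa> x p z} \<inter> {z. h 0 \<le> h z}"
    using h[of "h 0" 0] p by auto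
  ultimately obtain z where z: "h 0 \<le> h z"
      "\<forall>\<zeta>\<in>{z. h 0 \<le> height F \<kappa> x p z} \<inter> {z. h 0 \<le> h z}. h \<zeta> \<le> h z"
    using continuous_attains_sup[OF _ _ cont] by blast
  have "h \<zeta> \<le> h z" for \<zeta>
  proof (cases "h 0 \<le> h \<zeta>")
    case True
    then have "h 0 \<le> height F \<kappa> x p \<zeta>"
      using h p by blast
    then show ?thesis
      using True z(2) by blast
  qed (use z(1) in simp)
  then have "is_peak F \<kappa> A x z (h z)"
    unfolding is_peak_def using h order_trans by blast
  then show thesis ..
qed

section \<open>Wells' function on a finite set is the height of the peak\<close>

lemma inner_const_on_affine_hull:
  assumes "\<And>u u'. u \<in> X \<Longrightarrow> u' \<in> X \<Longrightarrow> v \<bullet> u = v \<bullet> u'"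
    and "u \<in> affine hull X" "u' \<in> affine hull X"
  shows "v \<bullet> u = v \<bullet> u'"
proof (cases "X = {}")
  case False
  then obtain u0 where u0: "u0 \<in> X"
    by blast
  have "affine hull X \<subseteq> {u. v \<bullet> u = v \<bullet> u0}"
  proof (intro hull_minimal affine_hyperplane subsetI CollectI)
    show "v \<bullet> u = v \<bullet> u0" if "u \<in> X" for u
      by (rule assms(1)[OF that u0])
  qed
  then have "v \<bullet> u = v \<bullet> u0" "v \<bullet> u' = v \<bullet> u0"
    using assms(2,3) by blast+
  then show ?thesis
    by simp
qed (use assms(2) in simp)

lemma midpoint_diff:
  fixes y z :: "'a::real_vector"
  shows "(1/2) *\<^sub>R (y + z) - z = (1/2) *\<^sub>R (y - z)"
proof -
  have "(1/2) *\<^sub>R (y + z) - (1/2) *\<^sub>R (z + z) = (1/2) *\<^sub>R (y - z)"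
    unfolding scaleR_right_diff_distrib[symmetric] by simp
  then show ?thesis
    by simp
qed

lemma wd_diff:
  "wd Plus F \<kappa> p z - wd Plus F \<kappa> p z' =
    \<kappa> / 4 * ((norm (z - wtilde Plus F \<kappa> p))\<^sup>2 - (norm (z' - wtilde Plus F \<kappa> p))\<^sup>2)"
  by (simp add: wd_def algebra_simps)

lemma wd_Pythagoras:
  assumes "(z - c) \<bullet> (c - wtilde Plus F \<kappa> p) = 0"
  shows "wd Plus F \<kappa> p z = wd Plus F \<kappa> p c + \<kappa> / 4 * (norm (z - c))\<^sup>2"
proof -
  have "(norm (z - wtilde Plus F \<kappa> p))\<^sup>2 = (norm (z - c))\<^sup>2 + (norm (c - wtilde Plus F \<kappa> p))\<^sup>2"
    using norm_add_Pythagorean[of "z - c" "c - wtilde Plus F \<kappa> p"] assms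
    by (simp add: orthogonal_def)
  then show ?thesis
    using wd_diff[of F \<kappa> p z c] by (simp add: algebra_simps)
qed

text \<open>The differences \<open>d\<^sub>p - d\<^sub>p\<^sub>'\<close> are affine with slope a multiple of \<open>p\<^sup>~ - p'\<^sup>~\<close>, so equality of all
\<open>d\<^sub>p\<close> at \<open>e\<close> and \<open>e'\<close> makes \<open>e - e'\<close> orthogonal to the direction space of \<open>S\<^sub>H\<close>.\<close>

lemma wS_E_orthogonal_wS_H:
  assumes "0 < \<kappa>" "e \<in> wS_E Plus F \<kappa> S" "e' \<in> wS_E Plus F \<kappa> S"
    "u \<in> wS_H Plus F \<kappa> S" "u' \<in> wS_H Plus F \<kappa> S"
  shows "(e - e') \<bullet> (u - u') = 0"
proof -
  have "(e - e') \<bullet> wtilde Plus F \<kappa> p = (e - e') \<bullet> wtilde Plus F \<kappa> p'" if "p \<in> S" "p' \<in> S" for p p'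
  proof -
    have "wd Plus F \<kappa> p e - wd Plus F \<kappa> p e' = wd Plus F \<kappa> p' e - wd Plus F \<kappa> p' e'"
      using assms(2,3) that unfolding wS_E_def mem_Collect_eq by metis
    then have "\<kappa> / 2 * ((e - e') \<bullet> wtilde Plus F \<kappa> p - (e - e') \<bullet> wtilde Plus F \<kappa> p') = 0"
      unfolding wd_diff power2_norm_eq_inner
      by (simp add: inner_diff_left inner_diff_right inner_commute algebra_simps)
    then show ?thesis
      using assms(1) by simp
  qed
  then have const: "(e - e') \<bullet> t = (e - e') \<bullet> t'"
    if "t \<in> wtilde Plus F \<kappa> ` S" "t' \<in> wtilde Plus F \<kappa> ` S" for t t'
    using that by blast
  have "(e - e') \<bullet> u = (e - e') \<bullet> u'"
    using inner_const_on_affine_hull[OF const] assms(4,5) unfolding wS_H_def by blast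
  then show ?thesis
    by (simp add: inner_diff_right)
qed

lemma infdist_eq_norm_of_orthogonal:
  fixes x e :: "'a::real_inner"
  assumes "e \<in> E" "\<And>e'. e' \<in> E \<Longrightarrow> (x - e) \<bullet> (e - e') = 0"
  shows "infdist x E = norm (x - e)"
proof (rule antisym)
  show "infdist x E \<le> norm (x - e)"
    using infdist_le[OF assms(1)] by (simp add: dist_norm)
  have "norm (x - e) \<le> dist x e'" if "e' \<in> E" for e'
  proof -
    have "(norm (x - e'))\<^sup>2 = (norm (x - e))\<^sup>2 + (norm (e - e'))\<^sup>2"
      using assms(2)[OF that] norm_add_Pythagorean[of "x - e" "e - e'"]
      by (simp add: orthogonal_def)
    then have "(norm (x - e))\<^sup>2 \<le> (norm (x - e'))\<^sup>2"
      by simp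
    then show ?thesis
      by (simp add: dist_norm)
  qed
  then show "norm (x - e) \<le> infdist x E"
    using assms(1) by (subst infdist_notempty) (auto intro: cINF_greatest)
qed

text \<open>The foot of the perpendicular from \<open>z\<close> to \<open>S\<^sub>H\<close> lies in \<open>S\<^sub>E\<close>, since by Pythagoras all \<open>d\<^sub>p\<close> drop by
the same amount between \<open>z\<close> and its foot. Orthogonality makes the common point unique.\<close>

lemma wS_C_foot:
  assumes \<kappa>: "0 < \<kappa>" and S: "S \<noteq> {}" and z: "z \<in> wS_E Plus F \<kappa> S"
  shows "wS_C Plus F \<kappa> S \<in> wS_E Plus F \<kappa> S \<inter> wS_H Plus F \<kappa> S"
proof -
  define H where "H = wS_H Plus F \<kappa> S"
  have H: "affine H" "closed H" "H \<noteq> {}"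
    using S by (auto simp: H_def wS_H_def)
  define c where "c = closest_point H z"
  have c: "c \<in> H"
    using H closest_point_in_set unfolding c_def by blast
  have orth: "(z - c) \<bullet> (u - c) = 0" if u: "u \<in> H" for u
  proof -
    have dot: "(z - c) \<bullet> (u - c) \<le> 0" if "u \<in> H" for u
      using closest_point_dot[OF affine_imp_convex[OF H(1)] H(2) that] by (simp add: c_def)
    \<comment> \<open>The inequality for closest points in convex sets becomes an equality on an affine set by
      reflecting \<open>u\<close> in \<open>c\<close>.\<close>
    have "2 *\<^sub>R c + (-1) *\<^sub>R u \<in> H"
      using H(1) c u by (intro mem_affine) auto
    from dot[OF this] dot[OF u] show ?thesis
      by (simp add: scaleR_2 inner_diff_right inner_add_right)
  qed
  have wdc: "wd Plus F \<kappa> p c = wd Plus F \<kappa> p z - \<kappa> / 4 * (norm (z - c))\<^sup>2" if "p \<in> S" for p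
  proof -
    have "wtilde Plus F \<kappa> p \<in> H"
      using that by (simp add: H_def wS_H_def hull_inc)
    then have "(z - c) \<bullet> (c - wtilde Plus F \<kappa> p) = 0"
      using orth[of "wtilde Plus F \<kappa> p"] by (simp add: inner_diff_right)
    then show ?thesis
      using wd_Pythagoras[of z c F \<kappa> p] by simp
  qed
  have cE: "c \<in> wS_E Plus F \<kappa> S"
    unfolding wS_E_def
  proof (intro CollectI ballI)
    fix p p' assume p: "p \<in> S" "p' \<in> S"
    then have "wd Plus F \<kappa> p z = wd Plus F \<kappa> p' z"
      using z unfolding wS_E_def by blast
    then show "wd Plus F \<kappa> p c = wd Plus F \<kappa> p' c"
      unfolding wdc[OF p(1)] wdc[OF p(2)] by simp
  qed
  have "\<exists>!c. c \<in> wS_E Plus F \<kappa> S \<inter> wS_H Plus F \<kappa> S"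
  proof (intro ex1I[of _ c])
    fix c' assume c': "c' \<in> wS_E Plus F \<kappa> S \<inter> wS_H Plus F \<kappa> S"
    then have "(c' - c) \<bullet> (c' - c) = 0"
      using c unfolding H_def by (intro wS_E_orthogonal_wS_H[OF \<kappa> _ cE]) auto
    then show "c' = c"
      by simp
  qed (use c cE in \<open>auto simp: H_def\<close>)
  from theI'[OF this] show ?thesis
    unfolding wS_C_def .
qed

text \<open>With \<open>c = S\<^sub>C\<close>, the vectors \<open>y - c\<close> and \<open>z - c\<close> are orthogonal. For \<open>x = (y + z)/2\<close> the distances
from \<open>x\<close> to \<open>S\<^sub>H\<close> and to \<open>S\<^sub>E\<close> are \<open>\<parallel>z - c\<parallel>/2\<close> and \<open>\<parallel>y - c\<parallel>/2\<close>, while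
\<open>d\<^sub>p(z) = d\<^sub>p(c) + \<kappa>/4 \<parallel>z - c\<parallel>\<^sup>2\<close> and
\<open>\<parallel>x - z\<parallel>\<^sup>2 = (\<parallel>y - c\<parallel>\<^sup>2 + \<parallel>z - c\<parallel>\<^sup>2)/4\<close>.\<close>

lemma wpiece_eq_height:
  assumes \<kappa>: "0 < \<kappa>" and p: "p \<in> S"
    and y: "y \<in> whull Plus F \<kappa> S" and z: "z \<in> wS_E Plus F \<kappa> S"
  shows "wpiece Plus F \<kappa> S ((1/2) *\<^sub>R (y + z)) = height F \<kappa> ((1/2) *\<^sub>R (y + z)) p z"
proof -
  define E where "E = wS_E Plus F \<kappa> S"
  define H where "H = wS_H Plus F \<kappa> S"
  define c where "c = wS_C Plus F \<kappa> S"
  define x where "x = (1/2) *\<^sub>R (y + z)"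
  have S: "S \<noteq> {}"
    using p by auto
  have c: "c \<in> E" "c \<in> H"
    using wS_C_foot[OF \<kappa> S z] by (auto simp: c_def E_def H_def)
  have orth: "(e - e') \<bullet> (u - u') = 0" if "e \<in> E" "e' \<in> E" "u \<in> H" "u' \<in> H" for e e' u u'
    using wS_E_orthogonal_wS_H[OF \<kappa>] that unfolding E_def H_def by blast
  have zE: "z \<in> E"
    using z by (simp add: E_def)
  have yH: "y \<in> H"
    using y convex_hull_subset_affine_hull unfolding H_def wS_H_def whull_def by blast
  have tH: "wtilde Plus F \<kappa> p \<in> H"
    using p by (simp add: H_def wS_H_def hull_inc)
  have H: "(1/2) *\<^sub>R (y + c) \<in> H"
  proof -
    have "affine H"
      by (simp add: H_def wS_H_def)
    then have "(1/2) *\<^sub>R y + (1/2) *\<^sub>R c \<in> H"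
      using yH c by (auto simp: affine_def)
    then show ?thesis
      by (simp add: scaleR_add_right)
  qed
  have wdz: "wd Plus F \<kappa> q z = wd Plus F \<kappa> q c + \<kappa> / 4 * (norm (z - c))\<^sup>2" if "q \<in> S" for q
  proof -
    have "wtilde Plus F \<kappa> q \<in> H"
      using that by (simp add: H_def wS_H_def hull_inc)
    from orth[OF zE c(1) c(2) this] show ?thesis
      by (rule wd_Pythagoras)
  qed
  have E: "(1/2) *\<^sub>R (z + c) \<in> E"
  proof -
    have d: "(1/2) *\<^sub>R (z + c) - c = (1/2) *\<^sub>R (z - c)"
      by (rule midpoint_diff)
    have mid: "wd Plus F \<kappa> q ((1/2) *\<^sub>R (z + c)) = wd Plus F \<kappa> q c + \<kappa> / 16 * (norm (z - c))\<^sup>2" 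
      if q: "q \<in> S" for q
    proof -
      have "wtilde Plus F \<kappa> q \<in> H"
        using q by (simp add: H_def wS_H_def hull_inc)
      from orth[OF zE c(1) c(2) this]
      have "((1/2) *\<^sub>R (z + c) - c) \<bullet> (c - wtilde Plus F \<kappa> q) = 0"
        unfolding d by simp
      from wd_Pythagoras[OF this] show ?thesis
        unfolding d by (simp add: power_divide)
    qed
    show ?thesis
      unfolding E_def wS_E_def
    proof (intro CollectI ballI)
      fix q q' assume q: "q \<in> S" "q' \<in> S"
      then have "wd Plus F \<kappa> q c = wd Plus F \<kappa> q' c"
        using c(1) unfolding E_def wS_E_def by blast
      then show "wd Plus F \<kappa> q ((1/2) *\<^sub>R (z + c)) = wd Plus F \<kappa> q' ((1/2) *\<^sub>R (z + c))"
        unfolding mid[OF q(1)] mid[OF q(2)] by simp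
    qed
  qed
  have dH: "infdist x H = norm (z - c) / 2"
  proof -
    have d: "x - (1/2) *\<^sub>R (y + c) = (1/2) *\<^sub>R (z - c)"
      by (simp add: x_def algebra_simps)
    show ?thesis
      using infdist_eq_norm_of_orthogonal[OF H, of x] orth[OF zE c(1) H] unfolding d by simp
  qed
  have dE: "infdist x E = norm (y - c) / 2"
  proof -
    have d: "x - (1/2) *\<^sub>R (z + c) = (1/2) *\<^sub>R (y - c)"
      by (simp add: x_def algebra_simps)
    show ?thesis
      using infdist_eq_norm_of_orthogonal[OF E, of x] orth[OF E _ yH c(2)] unfolding d
      by (simp add: inner_commute)
  qed
  have "wdset Plus F \<kappa> S c = (INF q\<in>S. ereal (wd Plus F \<kappa> p c))"
  proof -
    have "wd Plus F \<kappa> q c = wd Plus F \<kappa> p c" if "q \<in> S" for q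
      using c(1) p that unfolding E_def wS_E_def by blast
    then show ?thesis
      by simp
  qed
  then have wdset_c: "wdset Plus F \<kappa> S c = ereal (wd Plus F \<kappa> p c)"
    using S by simp
  have norm_xz: "(norm (x - z))\<^sup>2 = ((norm (y - c))\<^sup>2 + (norm (z - c))\<^sup>2) / 4"
  proof -
    have "x - z = (1/2) *\<^sub>R ((y - c) - (z - c))"
      using midpoint_diff[of y z] by (simp add: x_def)
    moreover have "(norm ((y - c) - (z - c)))\<^sup>2 = (norm (y - c))\<^sup>2 + (norm (z - c))\<^sup>2"
      using orth[OF zE c(1) yH c(2)] unfolding power2_norm_eq_inner
      by (simp add: inner_diff_left inner_diff_right inner_commute algebra_simps)
    ultimately show ?thesis
      by (simp add: power_divide)
  qed
  have "wpiece Plus F \<kappa> S x = height F \<kappa> x p z"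
    unfolding wpiece_def height_def wdz[OF p] c_def[symmetric] H_def[symmetric] E_def[symmetric]
      dH dE wdset_c norm_xz
    by (simp add: power_divide field_simps)
  then show ?thesis
    by (simp add: x_def)
qed

text \<open>First-order optimality. The gradient of the height of \<open>p\<close> at \<open>z\<close> is
\<open>\<kappa>/2 (2x - z - p\<^sup>~)\<close>. If \<open>2x - z\<close> were outside the hull of the active \<open>p\<^sup>~\<close>, a separating
hyperplane would give a direction in which every active height increases. The other heights
exceed \<open>M\<close> at \<open>z\<close>, hence also nearby, so a small step would beat the peak.\<close>

lemma peak_optimality:
  assumes \<kappa>: "0 < \<kappa>" and A: "finite A" "A \<noteq> {}" and peak: "is_peak F \<kappa> A x z M"
  shows "2 *\<^sub>R x - z \<in> whull Plus F \<kappa> {p\<in>A. height F \<kappa> x p z = M}"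
proof (rule ccontr)
  define S where "S = {p\<in>A. height F \<kappa> x p z = M}"
  define y where "y = 2 *\<^sub>R x - z"
  assume "2 *\<^sub>R x - z \<notin> whull Plus F \<kappa> {p\<in>A. height F \<kappa> x p z = M}"
  then have "y \<notin> whull Plus F \<kappa> S"
    by (simp add: y_def S_def)
  moreover have "closed (whull Plus F \<kappa> S)" "convex (whull Plus F \<kappa> S)"
    using A(1) by (auto simp: whull_def S_def intro!: compact_imp_closed finite_imp_compact_convex_hull)
  ultimately obtain v b where v: "v \<bullet> y < b" "\<And>u. u \<in> whull Plus F \<kappa> S \<Longrightarrow> b < v \<bullet> u"
    using separating_hyperplane_closed_point by metis
  have "\<forall>\<^sub>F t in at_right 0. M < height F \<kappa> x p (z + t *\<^sub>R (- v))" if p: "p \<in> A" for p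
  proof (cases "p \<in> S")
    case True
    then have "b < v \<bullet> wtilde Plus F \<kappa> p"
      by (intro v(2)) (simp add: whull_def hull_inc)
    then have s: "0 < \<kappa> / 2 * (v \<bullet> (wtilde Plus F \<kappa> p - y))"
      using v(1) \<kappa> by (simp add: inner_diff_right)
    have "((\<lambda>t. \<kappa> / 2 * (v \<bullet> (wtilde Plus F \<kappa> p - y)) - \<kappa> / 4 * t * (norm v)\<^sup>2) \<longlongrightarrow>
        \<kappa> / 2 * (v \<bullet> (wtilde Plus F \<kappa> p - y)) - \<kappa> / 4 * 0 * (norm v)\<^sup>2) (at_right 0)"
      by (intro tendsto_intros)
    then have "\<forall>\<^sub>F t in at_right 0.
        0 < \<kappa> / 2 * (v \<bullet> (wtilde Plus F \<kappa> p - y)) - \<kappa> / 4 * t * (norm v)\<^sup>2"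
      using s order_tendstoD(1)[where a = 0] by fastforce
    then show ?thesis
      using eventually_at_right_less
    proof eventually_elim
      case (elim t)
      then have "0 < t * (\<kappa> / 2 * (v \<bullet> (wtilde Plus F \<kappa> p - y)) - \<kappa> / 4 * t * (norm v)\<^sup>2)"
        by simp
      moreover have "height F \<kappa> x p z = M"
        using True by (simp add: S_def)
      ultimately show ?case
        unfolding height_move[OF \<kappa>]
        by (simp add: y_def power_mult_distrib power2_eq_square inner_diff_right algebra_simps)
    qed
  next
    case False
    then have "M < height F \<kappa> x p z"
      using p peak unfolding is_peak_def S_def by force
    moreover have "((\<lambda>t. height F \<kappa> x p (z + t *\<^sub>R (- v))) \<longlongrightarrow> height F \<kappa> x p (z + 0 *\<^sub>R (- v))) (at_right 0)"
      unfolding height_eq[OF \<kappa>] by (intro tendsto_intros)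
    ultimately show ?thesis
      by (intro order_tendstoD(1)) auto
  qed
  then have "\<forall>\<^sub>F t in at_right (0::real). \<forall>p\<in>A. M < height F \<kappa> x p (z + t *\<^sub>R (- v))"
    using A(1) by (simp add: eventually_ball_finite)
  then obtain t where t: "\<forall>p\<in>A. M < height F \<kappa> x p (z + t *\<^sub>R (- v))"
    using eventually_happens trivial_limit_at_right_real by blast
  define m where "m = Min ((\<lambda>p. height F \<kappa> x p (z + t *\<^sub>R (- v))) ` A)"
  have "M < m"
    using A t by (simp add: m_def)
  moreover have "m \<le> M"
  proof -
    have "\<forall>p\<in>A. m \<le> height F \<kappa> x p (z + t *\<^sub>R (- v))"
      using A(1) by (simp add: m_def)
    then show ?thesis
      using peak unfolding is_peak_def by blast
  qed
  ultimately show False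
    by simp
qed

text \<open>The converse of \<open>peak_optimality\<close>: the point \<open>z'\<close> with \<open>x = (y + z')/2\<close> attains the peak value. It
competes, because \<open>S\<^sub>*\<close> consists of points where \<open>S\<close> realises the minimum over \<open>A\<close>. And no \<open>z\<close> does
better, because \<open>y\<close> is in the hull of the \<open>p\<^sup>~\<close>, so some \<open>q \<in> S\<close> has a height that does not
increase to first order in the direction \<open>z - z'\<close>.\<close>

lemma wpiece_on_wT:
  assumes \<kappa>: "0 < \<kappa>" and peak: "is_peak F \<kappa> A x z M"
    and S: "S \<noteq> {}" "S \<subseteq> A" and x: "x \<in> wT Plus F A \<kappa> S"
  shows "wpiece Plus F \<kappa> S x = M"
proof -
  obtain y z' where y: "y \<in> whull Plus F \<kappa> S" and z': "z' \<in> wS_star Plus F A \<kappa> S"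
    and xyz: "x = (1/2) *\<^sub>R (y + z')"
    using x by (auto simp: wT_def)
  obtain p where p: "p \<in> S"
    using S by auto
  define m where "m = height F \<kappa> x p z'"
  have E: "z' \<in> wS_E Plus F \<kappa> S"
    using z' S(2) unfolding wS_E_def wS_star.simps by blast
  have eq: "height F \<kappa> x q z' = m" if "q \<in> S" for q
  proof -
    have "wd Plus F \<kappa> q z' = wd Plus F \<kappa> p z'"
      using E p that unfolding wS_E_def by blast
    then show ?thesis
      unfolding m_def height_def by simp
  qed
  have "m \<le> height F \<kappa> x q z'" if "q \<in> A" for q
  proof -
    have "wd Plus F \<kappa> p z' \<le> wd Plus F \<kappa> q z'"
      using z' p that unfolding wS_star.simps by blast
    then show ?thesis
      unfolding m_def height_def by simp
  qed
  then have "m \<le> M"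
    using peak unfolding is_peak_def by blast
  moreover have "M \<le> m"
  proof -
    have "\<exists>q\<in>S. (z - z') \<bullet> y \<le> (z - z') \<bullet> wtilde Plus F \<kappa> q"
    proof (rule ccontr)
      assume "\<not> (\<exists>q\<in>S. (z - z') \<bullet> y \<le> (z - z') \<bullet> wtilde Plus F \<kappa> q)"
      then have "whull Plus F \<kappa> S \<subseteq> {u. (z - z') \<bullet> u < (z - z') \<bullet> y}"
        unfolding whull_def by (intro hull_minimal convex_halfspace_lt) auto
      then show False
        using y by auto
    qed
    then obtain q where q: "q \<in> S" "(z - z') \<bullet> y \<le> (z - z') \<bullet> wtilde Plus F \<kappa> q"
      by blast
    have "M \<le> height F \<kappa> x q (z' + (z - z'))"
      using peak q(1) S(2) by (auto simp: is_peak_def)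
    also have "\<dots> = m + \<kappa> / 2 * ((z - z') \<bullet> (y - wtilde Plus F \<kappa> q)) - \<kappa> / 4 * (norm (z - z'))\<^sup>2"
      unfolding height_move[OF \<kappa>] eq[OF q(1)] by (simp add: xyz)
    also have "\<dots> \<le> m"
    proof -
      have "\<kappa> / 2 * ((z - z') \<bullet> (y - wtilde Plus F \<kappa> q)) \<le> 0"
        using q(2) \<kappa> by (simp add: inner_diff_right mult_nonneg_nonpos)
      moreover have "0 \<le> \<kappa> / 4 * (norm (z - z'))\<^sup>2"
        using \<kappa> by simp
      ultimately show ?thesis
        by linarith
    qed
    finally show ?thesis .
  qed
  ultimately show ?thesis
    using wpiece_eq_height[OF \<kappa> p y E] unfolding m_def xyz by simp
qed

text \<open>The set of those \<open>p\<close> whose height at the peak is minimal is a witness: the remaining points are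
strictly higher there, as membership in \<open>K\<close> demands.\<close>

lemma peak_in_cell:
  assumes \<kappa>: "0 < \<kappa>" and A: "finite A" "A \<noteq> {}" and peak: "is_peak F \<kappa> A x z M"
  obtains S where "S \<in> wK Plus F A \<kappa>" "x \<in> wT Plus F A \<kappa> S"
proof -
  define S where "S = {p\<in>A. height F \<kappa> x p z = M}"
  have y: "2 *\<^sub>R x - z \<in> whull Plus F \<kappa> S"
    using peak_optimality[OF assms] by (simp add: S_def)
  then have "S \<noteq> {}"
    by (auto simp: whull_def)
  then obtain p where p: "p \<in> S"
    by auto
  have low: "M \<le> height F \<kappa> x q z" if "q \<in> A" for q
    using peak that by (auto simp: is_peak_def)
  have star: "z \<in> wS_star Plus F A \<kappa> S"
  proof (unfold wS_star.simps, intro CollectI ballI conjI)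
    fix q q' q'' assume "q \<in> S" "q' \<in> S" "q'' \<in> A"
    then have "height F \<kappa> x q z = M" "height F \<kappa> x q' z = M" "M \<le> height F \<kappa> x q'' z"
      using low by (auto simp: S_def)
    then show "wd Plus F \<kappa> q z = wd Plus F \<kappa> q' z" "wd Plus F \<kappa> q' z \<le> wd Plus F \<kappa> q'' z"
      by (simp_all add: height_def)
  qed
  define b where "b = M + \<kappa> / 2 * (norm (x - z))\<^sup>2"
  have "wd Plus F \<kappa> q z = b" if "q \<in> S" for q
    using that by (auto simp: S_def height_def b_def)
  then have "wdset Plus F \<kappa> S z = ereal b"
    using \<open>S \<noteq> {}\<close> by simp
  also have "\<dots> < wdset Plus F \<kappa> (A - S) z"
  proof (cases "A - S = {}")
    case True
    show ?thesis
      unfolding wdset.simps True by (simp add: top_ereal_def)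
  next
    case False
    define b' where "b' = Min ((\<lambda>q. wd Plus F \<kappa> q z) ` (A - S))"
    have "b < b'"
      using False A(1) low unfolding b'_def b_def S_def height_def
      by (subst Min_gr_iff) (auto simp: less_le algebra_simps)
    moreover have "ereal b' \<le> wdset Plus F \<kappa> (A - S) z"
      using A(1) by (auto simp: b'_def intro!: INF_greatest)
    ultimately show ?thesis
      by (simp add: less_le_trans[of "ereal b" "ereal b'"])
  qed
  finally have strict: "wdset Plus F \<kappa> S z < wdset Plus F \<kappa> (A - S) z" .
  have "S \<subseteq> A"
    by (auto simp: S_def)
  then have "S \<in> wK Plus F A \<kappa>"
    unfolding wK.simps using star \<open>S \<noteq> {}\<close> strict by blast
  moreover have "x \<in> wT Plus F A \<kappa> S"
    unfolding wT_def
  proof (intro CollectI exI conjI)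
    show "x = (1/2) *\<^sub>R ((2 *\<^sub>R x - z) + z)"
      by simp
  qed (fact y, fact star)
  ultimately show thesis ..
qed

text \<open>All pieces whose cell contains \<open>x\<close> have the peak value there, and such a piece exists. The statement
has a free \<open>v\<close> so that it can be rewritten inside the definite description that defines Wells'
function, also after a change of sign.\<close>

lemma wells_cell_value_iff:
  assumes "0 < \<kappa>" "finite A" "A \<noteq> {}" "is_peak F \<kappa> A x z M"
  shows "(\<exists>S\<in>wK Plus F A \<kappa>. x \<in> wT Plus F A \<kappa> S \<and> v = wpiece Plus F \<kappa> S x) \<longleftrightarrow> v = M"
proof -
  have "wpiece Plus F \<kappa> S x = M" if "S \<in> wK Plus F A \<kappa>" "x \<in> wT Plus F A \<kappa> S" for S
    using that by (intro wpiece_on_wT[OF assms(1,4)]) auto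
  moreover obtain S where "S \<in> wK Plus F A \<kappa>" "x \<in> wT Plus F A \<kappa> S"
    using peak_in_cell[OF assms] .
  ultimately show ?thesis
    by metis
qed

lemma wells_eq_peak_value:
  assumes "0 < \<kappa>" "finite A" "A \<noteq> {}" "is_peak F \<kappa> A x z M"
  shows "wells Plus F A \<kappa> x = M"
  unfolding wells_def wells_cell_value_iff[OF assms] by simp

section \<open>Peaks over arbitrary sets\<close>

text \<open>The lower paraboloid at \<open>x\<close> has its vertex at \<open>x + D/\<kappa>\<close>, where \<open>D\<close> is the slope of the field at
\<open>x\<close>. Written without the vertex value, it has the same form as \<open>height_shift\<close>.\<close>

lemma lower_paraboloid_eq:
  assumes "0 < \<kappa>"
  shows "lower_paraboloid G \<kappa> x b =
    lower_paraboloid G \<kappa> x a + \<kappa> / 2 * (norm (a - (x + (1 / \<kappa>) *\<^sub>R fgrad G x)))\<^sup>2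
      - \<kappa> / 2 * (norm (b - (x + (1 / \<kappa>) *\<^sub>R fgrad G x)))\<^sup>2"
proof -
  define D where "D = (1 / \<kappa>) *\<^sub>R fgrad G x"
  have D: "fgrad G x = \<kappa> *\<^sub>R D"
    using assms by (simp add: D_def)
  show ?thesis
    unfolding D_def[symmetric] lower_paraboloid_def fpoly_def D power2_norm_eq_inner
    by (simp add: inner_diff_left inner_diff_right inner_add_left inner_add_right inner_commute
        algebra_simps)
qed

text \<open>At the vertex \<open>z\<close> of the lower paraboloid, passing from \<open>b\<close> to another point \<open>a\<close> changes both sides by the
same amount. It suffices to compare them at the midpoint \<open>a\<close> of \<open>z\<close> and \<open>p\<^sup>~\<close>, where the height
equals the upper paraboloid.\<close>

lemma lower_paraboloid_le_height:
  assumes \<kappa>: "0 < \<kappa>" and le: "\<And>a. lower_paraboloid G \<kappa> x a \<le> upper_paraboloid F \<kappa> p a"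
  shows "lower_paraboloid G \<kappa> x b \<le> height F \<kappa> b p (x + (1 / \<kappa>) *\<^sub>R fgrad G x)"
proof -
  define z where "z = x + (1 / \<kappa>) *\<^sub>R fgrad G x"
  define a where "a = (1/2) *\<^sub>R (wtilde Plus F \<kappa> p + z)"
  have "height F \<kappa> a p z = upper_paraboloid F \<kappa> p a"
    unfolding height_eq[OF \<kappa>] by (simp add: a_def)
  then show ?thesis
    unfolding z_def[symmetric] height_shift[of F \<kappa> b p z a]
      lower_paraboloid_eq[OF \<kappa>, of G x b a] using le[of a] by simp
qed

text \<open>The superlevel sets of the heights at the level of the infimum are compact, and finitely many of
them intersect in the peak of a finite subset, so all of them have a common point. The infimum is
one over real numbers: it is bounded below by the lower paraboloid of any point of \<open>\<Omega>\<close>.\<close>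

lemma peak_of_inf_wells:
  fixes F :: "'a::euclidean_space field1"
  assumes \<kappa>: "0 < \<kappa>" and \<Omega>: "\<Omega> \<noteq> {}"
    and le: "\<And>p q a. p \<in> \<Omega> \<Longrightarrow> q \<in> \<Omega> \<Longrightarrow> lower_paraboloid F \<kappa> q a \<le> upper_paraboloid F \<kappa> p a"
  obtains z where
    "is_peak F \<kappa> \<Omega> x z (INF P\<in>{P. P \<noteq> {} \<and> finite P \<and> P \<subseteq> \<Omega>}. wells Plus F P \<kappa> x)"
proof -
  define \<P> where "\<P> = {P. P \<noteq> {} \<and> finite P \<and> P \<subseteq> \<Omega>}"
  define M where "M = (INF P\<in>\<P>. wells Plus F P \<kappa> x)"
  have peak: "\<exists>z. is_peak F \<kappa> P x z (wells Plus F P \<kappa> x)" if "P \<in> \<P>" for P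
  proof -
    have P: "finite P" "P \<noteq> {}"
      using that by (auto simp: \<P>_def)
    obtain z m where z: "is_peak F \<kappa> P x z m"
      using finite_peak_exists[OF \<kappa> P] .
    from wells_eq_peak_value[OF \<kappa> P z] z show ?thesis
      by blast
  qed
  have below: "m \<le> wells Plus F P \<kappa> x"
    if "P \<in> \<P>" "\<And>p. p \<in> \<Omega> \<Longrightarrow> m \<le> height F \<kappa> x p \<zeta>" for m \<zeta> P
    using peak[OF that(1)] that unfolding is_peak_def \<P>_def by blast
  obtain q where q: "q \<in> \<Omega>"
    using \<Omega> by blast
  then have "{q} \<in> \<P>"
    by (simp add: \<P>_def)
  have "lower_paraboloid F \<kappa> q x \<le> wells Plus F P \<kappa> x" if "P \<in> \<P>" for P
    using lower_paraboloid_le_height[OF \<kappa> le[OF _ q]] by (rule below[OF that])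
  then have bdd: "bdd_below ((\<lambda>P. wells Plus F P \<kappa> x) ` \<P>)"
    by (rule bdd_belowI2)
  define C where "C p = {z. M \<le> height F \<kappa> x p z}" for p
  have C: "compact (C p)" for p
    unfolding C_def by (rule compact_superlevel_height[OF \<kappa>])
  \<comment> \<open>The point \<open>q\<close> is adjoined to each finite subset, since the empty one has no peak.\<close>
  have "C q \<inter> (\<Inter>p\<in>\<Omega>. C p) \<noteq> {}"
  proof (rule compact_imp_fip_image)
    show "compact (C q)" "\<And>p. closed (C p)"
      using C by (auto intro: compact_imp_closed)
    fix P assume P: "finite P" "P \<subseteq> \<Omega>"
    then have P': "insert q P \<in> \<P>"
      using q by (simp add: \<P>_def)
    then obtain z where "is_peak F \<kappa> (insert q P) x z (wells Plus F (insert q P) \<kappa> x)"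
      using peak by blast
    moreover have "M \<le> wells Plus F (insert q P) \<kappa> x"
      unfolding M_def by (rule cINF_lower[OF bdd P'])
    ultimately have "z \<in> C q \<inter> (\<Inter>p\<in>P. C p)"
      by (auto simp: C_def is_peak_def intro: order_trans)
    then show "C q \<inter> (\<Inter>p\<in>P. C p) \<noteq> {}"
      by blast
  qed
  then obtain z where "\<forall>p\<in>\<Omega>. M \<le> height F \<kappa> x p z"
    by (auto simp: C_def)
  moreover have "m \<le> M" if "\<forall>p\<in>\<Omega>. m \<le> height F \<kappa> x p \<zeta>" for m \<zeta>
    unfolding M_def using \<open>{q} \<in> \<P>\<close> below that by (intro cINF_greatest) blast+
  ultimately have "is_peak F \<kappa> \<Omega> x z M"
    unfolding is_peak_def by blast
  then show thesis
    unfolding M_def \<P>_def by (rule that)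
qed

section \<open>Fields with a quadratic Taylor bound\<close>

lemma GDERIV_of_quadratic_bound:
  fixes w :: "'a::euclidean_space \<Rightarrow> real"
  assumes "\<And>a. \<bar>w a - w x - D \<bullet> (a - x)\<bar> \<le> C * (norm (a - x))\<^sup>2"
  shows "GDERIV w x :> D"
  unfolding gderiv_def has_derivative_within
proof (intro conjI)
  show "bounded_linear (\<lambda>h. h \<bullet> D)"
    by (rule bounded_linear_inner_left)
  have "((\<lambda>a. C * norm (a - x)) \<longlongrightarrow> C * norm (x - x)) (at x)"
    by (intro tendsto_intros)
  then have "((\<lambda>a. C * norm (a - x)) \<longlongrightarrow> 0) (at x)"
    by simp
  then have "((\<lambda>a. \<bar>w a - w x - D \<bullet> (a - x)\<bar> / norm (a - x)) \<longlongrightarrow> 0) (at x)"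
  proof (rule Lim_null_comparison[rotated])
    have "\<bar>w a - w x - D \<bullet> (a - x)\<bar> / norm (a - x) \<le> C * norm (a - x)" if "a \<noteq> x" for a
      using assms[of a] that by (simp add: divide_le_eq power2_eq_square mult.assoc)
    then show "\<forall>\<^sub>F a in at x. norm (\<bar>w a - w x - D \<bullet> (a - x)\<bar> / norm (a - x)) \<le> C * norm (a - x)"
      by (auto simp: eventually_at_filter)
  qed
  then have "((\<lambda>a. norm ((1 / norm (a - x)) *\<^sub>R (w a - (w x + (a - x) \<bullet> D)))) \<longlongrightarrow> 0) (at x)"
    by (simp add: inner_commute diff_diff_eq abs_mult)
  then show "((\<lambda>a. (1 / norm (a - x)) *\<^sub>R (w a - (w x + (a - x) \<bullet> D))) \<longlongrightarrow> 0) (at x)"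
    by (rule tendsto_norm_zero_cancel)
qed

lemma gradient_eq:
  fixes w :: "'a::euclidean_space \<Rightarrow> real"
  assumes "GDERIV w x :> D"
  shows "gradient w x = D"
  unfolding gradient_def
proof (rule the_equality)
  show "GDERIV w x :> D"
    by (fact assms)
next
  fix D' assume "GDERIV w x :> D'"
  then have "(\<lambda>h. h \<bullet> D') = (\<lambda>h. h \<bullet> D)"
    using assms has_derivative_unique unfolding gderiv_def by blast
  then have "h \<bullet> D' = h \<bullet> D" for h
    by meson
  then show "D' = D"
    by (metis inner_commute vector_eq_rdot)
qed

lemma Gamma1_restrict_le:
  assumes "\<Omega> \<subseteq> \<Omega>'" "\<And>x. x \<in> \<Omega> \<Longrightarrow> fpoly G x = fpoly F x"
  shows "Gamma1 F \<Omega> \<le> Gamma1 G \<Omega>'"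
  unfolding Gamma1_def
proof (rule SUP_mono)
  fix p assume p: "p \<in> {(x, y). x \<in> \<Omega> \<and> y \<in> \<Omega> \<and> x \<noteq> y}"
  then have "p \<in> {(x, y). x \<in> \<Omega>' \<and> y \<in> \<Omega>' \<and> x \<noteq> y}"
      "(case p of (x, y) \<Rightarrow> Gamma1_at F x y) = (case p of (x, y) \<Rightarrow> Gamma1_at G x y)"
    using assms by (auto simp: Gamma1_at_def)
  then show "\<exists>p'\<in>{(x, y). x \<in> \<Omega>' \<and> y \<in> \<Omega>' \<and> x \<noteq> y}.
      (case p of (x, y) \<Rightarrow> Gamma1_at F x y) \<le> (case p' of (x, y) \<Rightarrow> Gamma1_at G x y)"
    by fastforce
qed

text \<open>The Taylor bound says that the graph of \<open>w\<close> lies between the lower and the upper paraboloid of each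
point, which separates these paraboloids and gives \<open>\<Gamma>\<^sup>1 \<le> \<kappa>\<close>. On \<open>\<Omega>\<close> the same bound for
the data of \<open>F\<close> identifies value and gradient of \<open>w\<close>; the reverse inequality for \<open>\<Gamma>\<^sup>1\<close> then holds
because the field extends \<open>F\<close>.\<close>

lemma is_MLE_assoc_field:
  fixes w :: "'a::euclidean_space \<Rightarrow> real"
  assumes \<kappa>: "0 \<le> \<kappa>" "Gamma1 F \<Omega> = ennreal \<kappa>"
    and taylor: "\<And>x a. \<bar>w a - w x - D x \<bullet> (a - x)\<bar> \<le> \<kappa> / 2 * (norm (a - x))\<^sup>2"
    and touch: "\<And>p a. p \<in> \<Omega> \<Longrightarrow> \<bar>w a - fpoly F p a\<bar> \<le> \<kappa> / 2 * (norm (a - p))\<^sup>2"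
  shows "is_MLE F \<Omega> (assoc_field w) UNIV"
proof -
  let ?W = "assoc_field w"
  have W: "fpoly ?W x a = w x + D x \<bullet> (a - x)" for x a
    using gradient_eq[OF GDERIV_of_quadratic_bound[OF taylor]]
    by (simp add: fpoly_def fval_def fgrad_def assoc_field_def)
  have same: "fpoly ?W p = fpoly F p" if p: "p \<in> \<Omega>" for p
  proof -
    have wp: "w p = fval F p"
      using touch[OF p, of p] by (simp add: fpoly_def)
    then have "\<bar>w a - w p - fgrad F p \<bullet> (a - p)\<bar> \<le> \<kappa> / 2 * (norm (a - p))\<^sup>2" for a
      using touch[OF p, of a] by (simp add: fpoly_def diff_diff_eq)
    then have "gradient w p = fgrad F p"
      by (rule gradient_eq[OF GDERIV_of_quadratic_bound])
    then show ?thesis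
      by (simp add: fun_eq_iff fpoly_def fval_def fgrad_def assoc_field_def wp[unfolded fval_def])
  qed
  have "lower_paraboloid ?W \<kappa> x a \<le> upper_paraboloid ?W \<kappa> y a" for x y a
    using taylor[of a x] taylor[of a y]
    unfolding lower_paraboloid_def upper_paraboloid_def W by linarith
  then have "Gamma1 ?W UNIV \<le> ennreal \<kappa>"
    using Gamma1_le_iff[OF \<kappa>(1)] by blast
  moreover have "Gamma1 F \<Omega> \<le> Gamma1 ?W UNIV"
    using same by (intro Gamma1_restrict_le) auto
  ultimately have "Gamma1 ?W UNIV = Gamma1 F \<Omega>"
    using \<kappa>(2) by simp
  then show ?thesis
    using same \<kappa>(2) by (simp add: is_MLE_def fields1_def)
qed

section \<open>The over extremal extension\<close>

text \<open>Interpolation and maximality both come from the fact that every lower paraboloid below all upper paraboloids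
of \<open>F\<close> is below \<open>w\<^sup>+\<close>. The conclusion speaks of the function rather than of its field, so that it
can be transported through a sign change.\<close>

lemma w_plus_properties:
  fixes F :: "'a::euclidean_space field1"
  assumes \<Omega>: "\<Omega> \<noteq> {}" and \<kappa>: "0 < \<kappa>" "Gamma1 F \<Omega> = ennreal \<kappa>"
  obtains D where "\<And>x a. \<bar>w_plus F \<Omega> a - w_plus F \<Omega> x - D x \<bullet> (a - x)\<bar> \<le> \<kappa> / 2 * (norm (a - x))\<^sup>2"
    and "\<And>p a. p \<in> \<Omega> \<Longrightarrow> \<bar>w_plus F \<Omega> a - fpoly F p a\<bar> \<le> \<kappa> / 2 * (norm (a - p))\<^sup>2"
    and "\<And>K x. is_MLE F \<Omega> K UNIV \<Longrightarrow> fval K x \<le> w_plus F \<Omega> x"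
proof -
  have le: "lower_paraboloid F \<kappa> q a \<le> upper_paraboloid F \<kappa> p a" if "p \<in> \<Omega>" "q \<in> \<Omega>" for p q a
    using Gamma1_le_iff[of \<kappa> F \<Omega>] \<kappa> that by simp
  have "\<exists>z. is_peak F \<kappa> \<Omega> x z (w_plus F \<Omega> x)" for x
    unfolding w_plus_def \<kappa>(2) using peak_of_inf_wells[OF \<kappa>(1) \<Omega> le, of x] \<kappa>(1) by auto
  then obtain Z where Z: "is_peak F \<kappa> \<Omega> x (Z x) (w_plus F \<Omega> x)" for x
    by metis
  have above: "lower_paraboloid G \<kappa> y x \<le> w_plus F \<Omega> x"
    if "\<And>p a. p \<in> \<Omega> \<Longrightarrow> lower_paraboloid G \<kappa> y a \<le> upper_paraboloid F \<kappa> p a" for G y x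
  proof -
    have "\<forall>p\<in>\<Omega>. lower_paraboloid G \<kappa> y x \<le> height F \<kappa> x p (y + (1 / \<kappa>) *\<^sub>R fgrad G y)"
      using lower_paraboloid_le_height[OF \<kappa>(1) that] by blast
    then show ?thesis
      using Z[of x] unfolding is_peak_def by blast
  qed
  show thesis
  proof
    fix x a
    show "\<bar>w_plus F \<Omega> a - w_plus F \<Omega> x - (\<kappa> *\<^sub>R (Z x - x)) \<bullet> (a - x)\<bar> \<le> \<kappa> / 2 * (norm (a - x))\<^sup>2"
      by (rule peak_taylor[OF \<kappa>(1) Z Z])
  next
    fix p a assume p: "p \<in> \<Omega>"
    have "w_plus F \<Omega> a \<le> height F \<kappa> a p (Z a)"
      using Z p unfolding is_peak_def by blast
    also have "\<dots> \<le> upper_paraboloid F \<kappa> p a"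
      unfolding height_eq[OF \<kappa>(1)] using \<kappa>(1) by simp
    finally show "\<bar>w_plus F \<Omega> a - fpoly F p a\<bar> \<le> \<kappa> / 2 * (norm (a - p))\<^sup>2"
      using above[OF le[OF _ p], of a] unfolding upper_paraboloid_def lower_paraboloid_def
      by linarith
  next
    fix K x assume K: "is_MLE F \<Omega> K UNIV"
    then have "Gamma1 K UNIV \<le> ennreal \<kappa>"
      using \<kappa>(2) by (simp add: is_MLE_def)
    then have "lower_paraboloid K \<kappa> x a \<le> upper_paraboloid K \<kappa> p a" for p a
      using Gamma1_le_iff[of \<kappa> K UNIV] \<kappa>(1) by simp
    moreover have "fpoly K p = fpoly F p" if "p \<in> \<Omega>" for p
      using K that by (simp add: is_MLE_def)
    ultimately have "lower_paraboloid K \<kappa> x a \<le> upper_paraboloid F \<kappa> p a" if "p \<in> \<Omega>" for p a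
      using that by (metis upper_paraboloid_def)
    from above[OF this, of x] show "fval K x \<le> w_plus F \<Omega> x"
      by (simp add: lower_paraboloid_def fpoly_def)
  qed
qed

section \<open>The under extremal extension by reflection\<close>

definition neg_field :: "'a::euclidean_space field1 \<Rightarrow> 'a field1" where
  "neg_field F p = (- fval F p, - fgrad F p)"

lemma fval_neg_field [simp]: "fval (neg_field F) p = - fval F p"
  and fgrad_neg_field [simp]: "fgrad (neg_field F) p = - fgrad F p"
  by (simp_all add: neg_field_def fval_def fgrad_def)

lemma fpoly_neg_field [simp]: "fpoly (neg_field F) p a = - fpoly F p a"
  by (simp add: fpoly_def)

lemma Gamma1_neg_field [simp]: "Gamma1 (neg_field F) \<Omega> = Gamma1 F \<Omega>"
  by (simp add: Gamma1_def Gamma1_at_def abs_minus_commute)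

lemma is_MLE_neg_field:
  "is_MLE F \<Omega> K \<Omega>' \<Longrightarrow> is_MLE (neg_field F) \<Omega> (neg_field K) \<Omega>'"
  by (simp add: is_MLE_def fields1_def fun_eq_iff)

context
  fixes F :: "'a::euclidean_space field1" and \<kappa> :: real
begin

lemma wtilde_Minus: "wtilde Minus F \<kappa> = wtilde Plus (neg_field F) \<kappa>"
  by (simp add: fun_eq_iff wtilde_def)

lemma wd_Minus: "wd Minus F \<kappa> p x = - wd Plus (neg_field F) \<kappa> p x"
  by (simp add: wd_def wtilde_Minus)

lemma wdset_Minus: "wdset Minus F \<kappa> S x = - wdset Plus (neg_field F) \<kappa> S x"
  by (simp add: wd_Minus ereal_SUP_uminus_eq flip: uminus_ereal.simps)

lemma whull_Minus: "whull Minus F \<kappa> S = whull Plus (neg_field F) \<kappa> S"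
  and wS_H_Minus: "wS_H Minus F \<kappa> S = wS_H Plus (neg_field F) \<kappa> S"
  and wS_E_Minus: "wS_E Minus F \<kappa> S = wS_E Plus (neg_field F) \<kappa> S"
  and wS_star_Minus: "wS_star Minus F A \<kappa> S = wS_star Plus (neg_field F) A \<kappa> S"
  by (simp_all add: whull_def wS_H_def wS_E_def wtilde_Minus wd_Minus)

lemma wK_Minus: "wK Minus F A \<kappa> = wK Plus (neg_field F) A \<kappa>"
  unfolding wK.simps wdset_Minus wS_star_Minus ereal_minus_less_minus ..

lemma wT_Minus: "wT Minus F A \<kappa> S = wT Plus (neg_field F) A \<kappa> S"
  unfolding wT_def whull_Minus wS_star_Minus ..

lemma wpiece_Minus: "wpiece Minus F \<kappa> S x = - wpiece Plus (neg_field F) \<kappa> S x"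
  unfolding wpiece_def wS_C_def wS_H_Minus wS_E_Minus wdset_Minus by simp

end

text \<open>The definite description is flipped by the sign only because its body determines a unique value;
hence the assumptions, which guarantee a peak.\<close>

lemma wells_Minus:
  assumes "0 < \<kappa>" "finite A" "A \<noteq> {}"
  shows "wells Minus F A \<kappa> x = - wells Plus (neg_field F) A \<kappa> x"
proof -
  obtain z M where peak: "is_peak (neg_field F) \<kappa> A x z M"
    using finite_peak_exists[OF assms] .
  have flip: "v = - t \<longleftrightarrow> - v = t" for v t :: real
    by linarith
  have "(\<exists>S\<in>wK Plus (neg_field F) A \<kappa>. x \<in> wT Plus (neg_field F) A \<kappa> S
      \<and> v = - wpiece Plus (neg_field F) \<kappa> S x) \<longleftrightarrow> v = - M" for v
    unfolding flip[of v] by (rule wells_cell_value_iff[OF assms peak])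
  then show ?thesis
    unfolding wells_eq_peak_value[OF assms peak]
    unfolding wells_def wK_Minus wT_Minus wpiece_Minus by simp
qed

lemma w_minus_eq:
  assumes "0 < enn2real (Gamma1 F \<Omega>)"
  shows "w_minus F \<Omega> x = - w_plus (neg_field F) \<Omega> x"
  unfolding w_minus_def w_plus_def Inf_real_def image_image Gamma1_neg_field
  using wells_Minus[OF assms] by (auto intro!: arg_cong[where f = Sup] image_cong)

theorem theorem47:
  fixes \<Omega> :: "(real ^ 'n) set" and F :: "(real ^ 'n) field1"
  assumes "\<Omega> \<noteq> {}" and "F \<in> fields1 \<Omega>" and "Gamma1 F \<Omega> > 0"
  shows "over_extremal F \<Omega> (assoc_field (w_plus F \<Omega>)) UNIV \<and>
         under_extremal F \<Omega> (assoc_field (w_minus F \<Omega>)) UNIV"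
proof -
  define \<kappa> where "\<kappa> = enn2real (Gamma1 F \<Omega>)"
  have \<kappa>: "0 < \<kappa>" "Gamma1 F \<Omega> = ennreal \<kappa>" "Gamma1 (neg_field F) \<Omega> = ennreal \<kappa>"
    using assms(2,3) by (simp_all add: \<kappa>_def fields1_def enn2real_positive_iff less_top)
  have minus: "w_minus F \<Omega> x = - w_plus (neg_field F) \<Omega> x" for x
    using w_minus_eq \<kappa>(1) unfolding \<kappa>_def .
  show ?thesis
  proof
    obtain D where D:
      "\<And>x a. \<bar>w_plus F \<Omega> a - w_plus F \<Omega> x - D x \<bullet> (a - x)\<bar> \<le> \<kappa> / 2 * (norm (a - x))\<^sup>2"
      "\<And>p a. p \<in> \<Omega> \<Longrightarrow> \<bar>w_plus F \<Omega> a - fpoly F p a\<bar> \<le> \<kappa> / 2 * (norm (a - p))\<^sup>2"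
      "\<And>K x. is_MLE F \<Omega> K UNIV \<Longrightarrow> fval K x \<le> w_plus F \<Omega> x"
      using w_plus_properties[OF assms(1) \<kappa>(1,2)] by blast
    have "is_MLE F \<Omega> (assoc_field (w_plus F \<Omega>)) UNIV"
      using \<kappa>(1,2) D(1,2) by (intro is_MLE_assoc_field) auto
    then show "over_extremal F \<Omega> (assoc_field (w_plus F \<Omega>)) UNIV"
      using D(3) by (simp add: over_extremal_def assoc_field_def fval_def)
  next
    let ?w = "w_plus (neg_field F) \<Omega>"
    obtain D where D:
      "\<And>x a. \<bar>?w a - ?w x - D x \<bullet> (a - x)\<bar> \<le> \<kappa> / 2 * (norm (a - x))\<^sup>2"
      "\<And>p a. p \<in> \<Omega> \<Longrightarrow> \<bar>?w a - fpoly (neg_field F) p a\<bar> \<le> \<kappa> / 2 * (norm (a - p))\<^sup>2"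
      "\<And>K x. is_MLE (neg_field F) \<Omega> K UNIV \<Longrightarrow> fval K x \<le> ?w x"
      using w_plus_properties[OF assms(1) \<kappa>(1,3)] by blast
    have "\<bar>w_minus F \<Omega> a - w_minus F \<Omega> x - (- D x) \<bullet> (a - x)\<bar> \<le> \<kappa> / 2 * (norm (a - x))\<^sup>2" for x a
      using D(1)[of a x] unfolding minus inner_minus_left by linarith
    moreover have "\<bar>w_minus F \<Omega> a - fpoly F p a\<bar> \<le> \<kappa> / 2 * (norm (a - p))\<^sup>2" if "p \<in> \<Omega>" for p a
      using D(2)[OF that, of a] unfolding minus fpoly_neg_field by linarith
    ultimately have "is_MLE F \<Omega> (assoc_field (w_minus F \<Omega>)) UNIV"
      using \<kappa>(1,2) by (intro is_MLE_assoc_field[where D = "\<lambda>x. - D x"]) auto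
    moreover have "w_minus F \<Omega> x \<le> fval K x" if "is_MLE F \<Omega> K UNIV" for K x
      using D(3)[OF is_MLE_neg_field[OF that], of x] unfolding minus by simp
    ultimately show "under_extremal F \<Omega> (assoc_field (w_minus F \<Omega>)) UNIV"
      by (simp add: under_extremal_def assoc_field_def fval_def)
  qed
qed

end
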